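(* Assume that $u_0$ satisfies hypothesis $(\mathbf{H_i})$ for some $i\in\{1,2,3\}$, where $(\mathbf{H_1})$: $u_0\in L^\infty(\Omega)$, $u_0\ge1$ a.e. in $\Omega$, $u_0\not\equiv1$; $(\mathbf{H_2})$: $u_0\in L^\infty(\Omega)$, $0\le u_0\le1$ a.e. in $\Omega$, $\int_\Omega g(u_0(x))\,dx\ne0$; $(\mathbf{H_3})$: $u_0\in L^\infty(\Omega)$, $u_0\le0$ a.e. in $\Omega$, $u_0\not\equiv0$. Let $\varphi\in\omega(u_0)$, let $E_{i\infty}:=\lim_{t\to\infty}E_i(u(t))$, and set $m_0:=\int_\Omega u_0$. Then: (i) If $(\mathbf{H_1})$ holds and $\varphi=\mu\chi_{A_1}+\chi_{\Omega\setminus A_1}$ with $\mu>1$, $A_1\subset\Omega$, $|A_1|\neq0$, then $$\mu|A_1|+|\Omega|-|A_1|=m_0,\qquad \mathcal{P}(\mu)|A_1|+\mathcal{P}(1)(|\Omega|-|A_1|)=E_{1\infty}.$$ (ii) If $(\mathbf{H_2})$ holds and $\varphi=\chi_{A_1}+\nu\chi_{A_2}$ with $0<\nu<1$, $A_1,A_2\subset\Omega$, $A_1\cap A_2=\emptyset$, then $$|A_1|+\nu|A_2|=m_0,\qquad \mathcal{P}(1)|A_1|+\mathcal{P}(\nu)|A_2|=-E_{2\infty}.$$ (iii) If $(\mathbf{H_3})$ holds and $\varphi=\xi\chi_{A_1}$ with $\xi<0$, $A_1\subset\Omega$, $|A_1|\neq0$, then $$\xi|A_1|=m_0,\qquad 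\mathcal{P}(\xi)|A_1|=E_{3\infty}.$$
   Context: Standing assumptions: $\Omega\subset\mathbb{R}^N$ ($N\ge1$) is an open bounded set; $p\in C^1(\mathbb{R})$ is strictly increasing on $\mathbb{R}$; $g\in C^1(\mathbb{R})$ satisfies $g(0)=g(1)=0$, $g>0$ on $(0,1)$ and $g<0$ on $(-\infty,0)\cup(1,\infty)$. For $v\in L^\infty(\Omega)$ with $\int_\Omega g(v)\ne0$ put $F(v):=g(v)p(v)-g(v)\dfrac{\int_\Omega g(v)p(v)}{\int_\Omega g(v)}$. Problem $(P)$ is the initial value problem $u_t=F(u)$, $t\ge0$, $u(x,0)=u_0(x)$, $x\in\Omega$. For $0<T\le\infty$, a function $u\in C^1([0,T);L^\infty(\Omega))$ is a solution of $(P)$ on $[0,T)$ if $u(0)=u_0$, $\int_\Omega g(u(t))\ne0$ for all $t\in[0,T)$, and $\frac{du}{dt}=F(u)$ on the whole interval $[0,T)$. Under any of $(\mathbf{H_1})$, $(\mathbf{H_2})$, $(\mathbf{H_3})$, Problem $(P)$ has a unique solution $u$ on $[0,\infty)$, and the $\omega$-limit set is $\omega(u_0):=\{\varphi\in L^1(\Omega):\exists\, t_n\to\infty,\ u(t_n)\to\varphi \text{ in } L^1(\Omega)\text{ as } n\to\infty\}$. Set $\mathcal{P}(s):=\int_0^s p(\tau)\,d\tau$ and, for $i=1,2,3$, $E_i(v):=(-1)^{i+1}\int_\Omega\mathcal{P}(v)$. Under $(\mathbf{H_i})$ the limit $E_{i\infty}=\lim_{t\to\infty}E_i(u(t))$ exists.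 $\chi_A$ denotes the characteristic function of the measurable set $A$ and $|A|$ its Lebesgue measure. Under $(\mathbf{H_1})$, $(\mathbf{H_2})$, $(\mathbf{H_3})$ respectively, every $\varphi\in\omega(u_0)$ admits a representation of the form appearing in (i), (ii), (iii). *)

theory Defs
  imports "HOL-Probability.Essential_Supremum"
begin

text \<open>
  Elements of \<open>L\<^sup>\<infinity>(\<Omega>)\<close> and \<open>L\<^sup>1(\<Omega>)\<close> are represented by functions on the whole space, of which only
  the restriction to \<open>\<Omega>\<close>, up to Lebesgue-null sets, is ever used. Since the essential supremum is taken
  in \<^typ>\<open>ennreal\<close>, it is \<open>0\<close> (and not \<open>-\<infinity>\<close>) over a null set.
\<close>

definition Linf_norm :: "'a::euclidean_space set \<Rightarrow> ('a \<Rightarrow> real) \<Rightarrow> ennreal" where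
  "Linf_norm \<Omega> f = esssup (lebesgue_on \<Omega>) (\<lambda>x. ennreal \<bar>f x\<bar>)"

definition Linf :: "'a::euclidean_space set \<Rightarrow> ('a \<Rightarrow> real) set" where
  "Linf \<Omega> = {f \<in> borel_measurable (lebesgue_on \<Omega>). Linf_norm \<Omega> f < \<infinity>}"

text \<open>The derivative at \<open>t\<close>, within \<open>I\<close> and in the norm of \<open>L\<^sup>\<infinity>(\<Omega>)\<close>, of a curve \<open>u\<close> in \<open>L\<^sup>\<infinity>(\<Omega>)\<close>;
  it is one-sided at an endpoint of \<open>I\<close>.\<close>

definition has_Linf_derivative ::
    "'a::euclidean_space set \<Rightarrow> (real \<Rightarrow> 'a \<Rightarrow> real) \<Rightarrow> ('a \<Rightarrow> real) \<Rightarrow> real \<Rightarrow> real set \<Rightarrow> bool" where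
  "has_Linf_derivative \<Omega> u w t I \<longleftrightarrow>
     w \<in> Linf \<Omega> \<and>
     ((\<lambda>s. Linf_norm \<Omega> (\<lambda>x. (u s x - u t x) / (s - t) - w x)) \<longlongrightarrow> 0) (at t within I)"

definition continuous_on_Linf ::
    "'a::euclidean_space set \<Rightarrow> real set \<Rightarrow> (real \<Rightarrow> 'a \<Rightarrow> real) \<Rightarrow> bool" where
  "continuous_on_Linf \<Omega> I w \<longleftrightarrow>
     (\<forall>t\<in>I. w t \<in> Linf \<Omega> \<and> ((\<lambda>s. Linf_norm \<Omega> (\<lambda>x. w s x - w t x)) \<longlongrightarrow> 0) (at t within I))"

definition C1_Linf ::
    "'a::euclidean_space set \<Rightarrow> real set \<Rightarrow> (real \<Rightarrow> 'a \<Rightarrow> real) \<Rightarrow> bool" where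
  "C1_Linf \<Omega> I u \<longleftrightarrow>
     (\<forall>t\<in>I. u t \<in> Linf \<Omega>) \<and>
     (\<exists>u'. (\<forall>t\<in>I. has_Linf_derivative \<Omega> u (u' t) t I) \<and> continuous_on_Linf \<Omega> I u')"

text \<open>The nonlocal right-hand side, meaningful only if \<open>\<integral>\<^sub>\<Omega> g(v) \<noteq> 0\<close>.\<close>

definition nonlocal_F ::
    "'a::euclidean_space set \<Rightarrow> (real \<Rightarrow> real) \<Rightarrow> (real \<Rightarrow> real) \<Rightarrow> ('a \<Rightarrow> real) \<Rightarrow> 'a \<Rightarrow> real" where
  "nonlocal_F \<Omega> p g v = (\<lambda>x. g (v x) * p (v x) -
     g (v x) * ((LINT y|lebesgue_on \<Omega>. g (v y) * p (v y)) / (LINT y|lebesgue_on \<Omega>. g (v y))))"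

text \<open>\<open>u\<close> solves \<open>u\<^sub>t = F(u)\<close>, \<open>u(0) = u\<^sub>0\<close> on \<open>[0,T)\<close>, where \<open>0 < T \<le> \<infinity>\<close>.\<close>

definition solution_P ::
    "'a::euclidean_space set \<Rightarrow> (real \<Rightarrow> real) \<Rightarrow> (real \<Rightarrow> real) \<Rightarrow> ('a \<Rightarrow> real) \<Rightarrow> ereal
      \<Rightarrow> (real \<Rightarrow> 'a \<Rightarrow> real) \<Rightarrow> bool" where
  "solution_P \<Omega> p g u\<^sub>0 T u \<longleftrightarrow>
     0 < T \<and>
     (let I = {t. 0 \<le> t \<and> ereal t < T} in
        C1_Linf \<Omega> I u \<and>
        (AE x in lebesgue_on \<Omega>. u 0 x = u\<^sub>0 x) \<and>
        (\<forall>t\<in>I. (LINT x|lebesgue_on \<Omega>. g (u t x)) \<noteq> 0 \<and>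
               has_Linf_derivative \<Omega> u (nonlocal_F \<Omega> p g (u t)) t I))"

definition omega_limit ::
    "'a::euclidean_space set \<Rightarrow> (real \<Rightarrow> 'a \<Rightarrow> real) \<Rightarrow> ('a \<Rightarrow> real) set" where
  "omega_limit \<Omega> u =
     {\<phi>. integrable (lebesgue_on \<Omega>) \<phi> \<and>
         (\<exists>t :: nat \<Rightarrow> real. (\<forall>n. 0 \<le> t n) \<and> filterlim t at_top sequentially \<and>
            (\<lambda>n. LINT x|lebesgue_on \<Omega>. \<bar>u (t n) x - \<phi> x\<bar>) \<longlonglongrightarrow> 0)}"

text \<open>\<open>\<integral>\<^sub>0\<^sup>s p\<close>, an oriented integral: for \<open>s < 0\<close> it is \<open>-\<integral>\<^sub>s\<^sup>0 p\<close>.\<close>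

definition primitive :: "(real \<Rightarrow> real) \<Rightarrow> real \<Rightarrow> real" where
  "primitive p s = interval_lebesgue_integral lborel (ereal 0) (ereal s) p"

definition energy ::
    "nat \<Rightarrow> 'a::euclidean_space set \<Rightarrow> (real \<Rightarrow> real) \<Rightarrow> ('a \<Rightarrow> real) \<Rightarrow> real" where
  "energy i \<Omega> p v = (-1) ^ (i + 1) * (LINT x|lebesgue_on \<Omega>. primitive p (v x))"

definition energy_limit ::
    "nat \<Rightarrow> 'a::euclidean_space set \<Rightarrow> (real \<Rightarrow> real) \<Rightarrow> (real \<Rightarrow> 'a \<Rightarrow> real) \<Rightarrow> real" where
  "energy_limit i \<Omega> p u = Lim at_top (\<lambda>t. energy i \<Omega> p (u t))"

definition H1 :: "'a::euclidean_space set \<Rightarrow> ('a \<Rightarrow> real) \<Rightarrow> bool" where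
  "H1 \<Omega> u\<^sub>0 \<longleftrightarrow> u\<^sub>0 \<in> Linf \<Omega> \<and> (AE x in lebesgue_on \<Omega>. 1 \<le> u\<^sub>0 x) \<and>
     \<not> (AE x in lebesgue_on \<Omega>. u\<^sub>0 x = 1)"

definition H2 :: "'a::euclidean_space set \<Rightarrow> (real \<Rightarrow> real) \<Rightarrow> ('a \<Rightarrow> real) \<Rightarrow> bool" where
  "H2 \<Omega> g u\<^sub>0 \<longleftrightarrow> u\<^sub>0 \<in> Linf \<Omega> \<and> (AE x in lebesgue_on \<Omega>. 0 \<le> u\<^sub>0 x \<and> u\<^sub>0 x \<le> 1) \<and>
     (LINT x|lebesgue_on \<Omega>. g (u\<^sub>0 x)) \<noteq> 0"

definition H3 :: "'a::euclidean_space set \<Rightarrow> ('a \<Rightarrow> real) \<Rightarrow> bool" where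
  "H3 \<Omega> u\<^sub>0 \<longleftrightarrow> u\<^sub>0 \<in> Linf \<Omega> \<and> (AE x in lebesgue_on \<Omega>. u\<^sub>0 x \<le> 0) \<and>
     \<not> (AE x in lebesgue_on \<Omega>. u\<^sub>0 x = 0)"

end

theory Submission
  imports Defs
begin

text \<open>
  For \<open>\<psi>\<close> of class \<open>C\<^sup>1\<close> the curve \<open>t \<mapsto> \<integral>\<^sub>\<Omega> \<psi>(u(t))\<close> has the derivative \<open>\<integral>\<^sub>\<Omega> \<psi>'(u) F(u)\<close>. The choice
  \<open>\<psi>(s) = s\<close> gives conservation of mass. With \<open>\<psi>\<close> the squared distance to a half-line that ends at a zero
  of \<open>g\<close>, Gronwall's inequality shows that the flow preserves \<open>u \<ge> 1\<close>, \<open>0 \<le> u \<le> 1\<close> and \<open>u \<le> 0\<close>. Hence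
  \<open>g(u)\<close> has constant sign, and since \<open>F(u) = g(u) (p(u) - \<lambda>)\<close>, where \<open>\<lambda>\<close> is the \<open>g(u)\<close>-weighted mean of
  \<open>p(u)\<close>, Chebyshev's inequality makes \<open>\<integral>\<^sub>\<Omega> \<psi>(u(t))\<close> monotone for every convex \<open>\<psi>\<close>. This yields the
  uniform bound on \<open>u\<close> (again with a squared distance) and, with \<open>\<psi>\<close> the primitive of \<open>p\<close>, the
  monotone convergence of the energy; its limit is identified along the sequence that defines \<open>\<phi>\<close>.
\<close>

section \<open>Local Lipschitz bounds and integrability of superpositions\<close>

lemma C1_lipschitz_on_bounded:
  fixes f f' :: "real \<Rightarrow> real"
  assumes f: "\<And>s. (f has_real_derivative f' s) (at s)" and f': "continuous_on UNIV f'"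
  obtains B where "0 \<le> B" "\<And>x y. \<bar>x\<bar> \<le> R \<Longrightarrow> \<bar>y\<bar> \<le> R \<Longrightarrow> \<bar>f x - f y\<bar> \<le> B * \<bar>x - y\<bar>"
proof -
  have "bounded (f' ` {-R..R})"
    by (intro compact_imp_bounded compact_continuous_image continuous_on_subset[OF f']) auto
  then obtain B where B: "0 < B" "\<And>x. x \<in> {-R..R} \<Longrightarrow> norm (f' x) \<le> B"
    unfolding bounded_pos by auto
  have "\<bar>f x - f y\<bar> \<le> B * \<bar>x - y\<bar>" if "\<bar>x\<bar> \<le> R" "\<bar>y\<bar> \<le> R" for x y
    using field_differentiable_bound[of "{-R..R}" f f' B y x] that B(2) has_field_derivative_at_within[OF f]
    by (auto simp: abs_le_iff abs_minus_commute)
  with B(1) that[of B] show thesis by auto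
qed

lemma Linf_measurable: "v \<in> Linf \<Omega> \<Longrightarrow> v \<in> borel_measurable (lebesgue_on \<Omega>)"
  by (simp add: Linf_def)

lemma Linf_AE_bounded:
  assumes "v \<in> Linf \<Omega>"
  obtains R where "0 \<le> R" "AE x in lebesgue_on \<Omega>. \<bar>v x\<bar> \<le> R"
proof -
  define R where "R = enn2real (Linf_norm \<Omega> v)"
  have "Linf_norm \<Omega> v = ennreal R"
    using assms by (simp add: Linf_def R_def ennreal_enn2real)
  moreover have "AE x in lebesgue_on \<Omega>. ennreal \<bar>v x\<bar> \<le> Linf_norm \<Omega> v"
    unfolding Linf_norm_def by (rule esssup_AE)
  moreover have "0 \<le> R" by (simp add: R_def)
  ultimately have "AE x in lebesgue_on \<Omega>. \<bar>v x\<bar> \<le> R"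
    by simp
  then show thesis using that[of R] by (auto simp: R_def)
qed

lemma continuous_comp_measurable:
  fixes \<psi> :: "real \<Rightarrow> real"
  assumes "continuous_on UNIV \<psi>" "v \<in> borel_measurable M"
  shows "(\<lambda>x. \<psi> (v x)) \<in> borel_measurable M"
  using measurable_compose[OF assms(2) borel_measurable_continuous_onI[OF assms(1)]] .

lemma continuous_bounded_on_abs_le:
  fixes \<psi> :: "real \<Rightarrow> real"
  assumes "continuous_on UNIV \<psi>"
  obtains B where "0 \<le> B" "\<And>s. \<bar>s\<bar> \<le> R \<Longrightarrow> \<bar>\<psi> s\<bar> \<le> B"
proof -
  have "bounded (\<psi> ` {-R..R})"
    by (intro compact_imp_bounded compact_continuous_image continuous_on_subset[OF assms]) auto
  then obtain B where "0 < B" "\<And>x. x \<in> {-R..R} \<Longrightarrow> norm (\<psi> x) \<le> B"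
    unfolding bounded_pos by auto
  then show thesis using that[of B] by (auto simp: abs_le_iff)
qed

lemma integrable_continuous_comp:
  fixes \<psi> :: "real \<Rightarrow> real"
  assumes \<Omega>: "\<Omega> \<in> lmeasurable" and \<psi>: "continuous_on UNIV \<psi>"
    and v: "v \<in> borel_measurable (lebesgue_on \<Omega>)" "AE x in lebesgue_on \<Omega>. \<bar>v x\<bar> \<le> R"
  shows "integrable (lebesgue_on \<Omega>) (\<lambda>x. \<psi> (v x))"
proof -
  obtain B where "0 \<le> B" "\<And>s. \<bar>s\<bar> \<le> R \<Longrightarrow> \<bar>\<psi> s\<bar> \<le> B"
    by (rule continuous_bounded_on_abs_le[OF \<psi>, of R]) blast
  then show ?thesis
    using v(2)
    by (intro finite_measure.integrable_const_bound[OF finite_measure_lebesgue_on[OF \<Omega>], of _ B]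
          continuous_comp_measurable[OF \<psi> v(1)]) (auto elim!: eventually_mono)
qed

section \<open>Differentiating integrals along a curve in L-infinity\<close>

text \<open>Each index contributes one exceptional null set, and countably many of them still form a
  null set; so convergence in the essential supremum becomes convergence at almost every point. With
  the eventual bound by 1 this is the input for dominated convergence.\<close>

lemma has_Linf_derivative_sequentially:
  assumes u: "has_Linf_derivative \<Omega> u w t I" and X: "\<And>i. X i \<in> I - {t}" "X \<longlonglongrightarrow> t"
  shows "AE x in lebesgue_on \<Omega>. (\<lambda>i. (u (X i) x - u t x) / (X i - t)) \<longlonglongrightarrow> w x"
    and "\<forall>\<^sub>F i in sequentially.
           AE x in lebesgue_on \<Omega>. \<bar>(u (X i) x - u t x) / (X i - t) - w x\<bar> \<le> 1"
proof -
  define q where "q i x = (u (X i) x - u t x) / (X i - t)" for i x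
  have lim: "(\<lambda>i. Linf_norm \<Omega> (\<lambda>x. q i x - w x)) \<longlonglongrightarrow> 0"
    using u X unfolding has_Linf_derivative_def tendsto_at_iff_sequentially comp_def q_def by blast
  have le: "AE x in lebesgue_on \<Omega>. ennreal \<bar>q i x - w x\<bar> \<le> Linf_norm \<Omega> (\<lambda>x. q i x - w x)" for i
    unfolding Linf_norm_def by (rule esssup_AE)
  then have "AE x in lebesgue_on \<Omega>. \<forall>i. ennreal \<bar>q i x - w x\<bar> \<le> Linf_norm \<Omega> (\<lambda>x. q i x - w x)"
    by (simp add: AE_all_countable)
  then show "AE x in lebesgue_on \<Omega>. (\<lambda>i. (u (X i) x - u t x) / (X i - t)) \<longlonglongrightarrow> w x"
  proof (rule eventually_mono)
    fix x assume x: "\<forall>i. ennreal \<bar>q i x - w x\<bar> \<le> Linf_norm \<Omega> (\<lambda>x. q i x - w x)"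
    have "(\<lambda>i. ennreal \<bar>q i x - w x\<bar>) \<longlonglongrightarrow> ennreal 0"
      using tendsto_sandwich[OF _ _ tendsto_const lim, of "\<lambda>i. ennreal \<bar>q i x - w x\<bar>"] x by simp
    then have "(\<lambda>i. \<bar>q i x - w x\<bar>) \<longlonglongrightarrow> 0"
      by (rule tendsto_ennrealD) auto
    then show "(\<lambda>i. (u (X i) x - u t x) / (X i - t)) \<longlonglongrightarrow> w x"
      unfolding q_def by (simp add: LIM_zero_iff tendsto_rabs_zero_iff)
  qed
  have "\<forall>\<^sub>F i in sequentially. Linf_norm \<Omega> (\<lambda>x. q i x - w x) < 1"
    using lim by (rule order_tendstoD) simp
  then show "\<forall>\<^sub>F i in sequentially.
           AE x in lebesgue_on \<Omega>. \<bar>(u (X i) x - u t x) / (X i - t) - w x\<bar> \<le> 1"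
  proof (rule eventually_mono)
    fix i assume i: "Linf_norm \<Omega> (\<lambda>x. q i x - w x) < 1"
    show "AE x in lebesgue_on \<Omega>. \<bar>(u (X i) x - u t x) / (X i - t) - w x\<bar> \<le> 1"
      using le[of i]
    proof (rule eventually_mono)
      fix x assume "ennreal \<bar>q i x - w x\<bar> \<le> Linf_norm \<Omega> (\<lambda>x. q i x - w x)"
      then have "ennreal \<bar>q i x - w x\<bar> \<le> ennreal 1"
        using i by (metis ennreal_1 less_imp_le order_trans)
      then show "\<bar>(u (X i) x - u t x) / (X i - t) - w x\<bar> \<le> 1"
        by (subst (asm) ennreal_le_iff) (auto simp: q_def)
    qed
  qed
qed

text \<open>Dominated convergence for the difference quotients of \<psi>(u). The Lipschitz constant
  of \<psi> on a bounded range supplies a constant majorant, integrable because \<Omega> has finite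
  measure.\<close>

lemma has_Linf_derivative_integral_comp:
  fixes \<psi> \<psi>' :: "real \<Rightarrow> real"
  assumes \<Omega>: "\<Omega> \<in> lmeasurable"
    and u: "\<And>s. s \<in> I \<Longrightarrow> u s \<in> Linf \<Omega>" and t: "t \<in> I"
    and der: "has_Linf_derivative \<Omega> u w t I"
    and \<psi>: "\<And>s. (\<psi> has_real_derivative \<psi>' s) (at s)" and \<psi>': "continuous_on UNIV \<psi>'"
  shows "((\<lambda>s. LINT x|lebesgue_on \<Omega>. \<psi> (u s x)) has_real_derivative
            (LINT x|lebesgue_on \<Omega>. \<psi>' (u t x) * w x)) (at t within I)"
  unfolding has_field_derivative_iff tendsto_at_iff_sequentially comp_def
proof (intro allI impI)
  fix X assume X: "\<forall>i. X i \<in> I - {t}" "X \<longlonglongrightarrow> t"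
  let ?M = "lebesgue_on \<Omega>"
  interpret finite_measure ?M by (rule finite_measure_lebesgue_on[OF \<Omega>])
  have c\<psi>: "continuous_on UNIV \<psi>"
    by (rule DERIV_continuous_on) (rule \<psi>)
  have w: "w \<in> Linf \<Omega>" using der by (simp add: has_Linf_derivative_def)
  note meas = Linf_measurable[OF u] Linf_measurable[OF w]
  obtain R where R: "0 \<le> R" "AE x in ?M. \<bar>u t x\<bar> \<le> R" by (rule Linf_AE_bounded[OF u[OF t]])
  obtain W where W: "0 \<le> W" "AE x in ?M. \<bar>w x\<bar> \<le> W" by (rule Linf_AE_bounded[OF w])
  \<comment> \<open>Once \<open>\<bar>q i x - w x\<bar> \<le> 1\<close> and
    \<open>\<bar>X i - t\<bar> < 1\<close>, the value \<open>u (X i) x\<close> differs from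
    \<open>u t x\<close> by at most W + 1. One Lipschitz constant on this radius serves all late
    indices.\<close>
  obtain B where B: "0 \<le> B"
    "\<And>x y. \<bar>x\<bar> \<le> R + (W + 1) \<Longrightarrow> \<bar>y\<bar> \<le> R + (W + 1) \<Longrightarrow> \<bar>\<psi> x - \<psi> y\<bar> \<le> B * \<bar>x - y\<bar>"
    by (rule C1_lipschitz_on_bounded[OF \<psi> \<psi>', of "R + (W + 1)"]) blast
  define q where "q i x = (u (X i) x - u t x) / (X i - t)" for i x
  have Xt: "X i - t \<noteq> 0" for i using X(1) by auto
  have uX: "u (X i) x = u t x + (X i - t) * q i x" for i x using Xt[of i] by (simp add: q_def)
  have q1: "AE x in ?M. (\<lambda>i. q i x) \<longlonglongrightarrow> w x"
    and q2: "\<forall>\<^sub>F i in sequentially. AE x in ?M. \<bar>q i x - w x\<bar> \<le> 1"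
    using has_Linf_derivative_sequentially[OF der, of X] X unfolding q_def by auto
  have "\<forall>\<^sub>F i in sequentially. \<bar>X i - t\<bar> < 1"
    using tendstoD[OF X(2), of 1] by (simp add: dist_real_def)
  with q2 have "\<forall>\<^sub>F i in sequentially. (AE x in ?M. \<bar>q i x - w x\<bar> \<le> 1) \<and> \<bar>X i - t\<bar> < 1"
    by (rule eventually_conj)
  then obtain N where N: "\<And>i. i \<ge> N \<Longrightarrow> AE x in ?M. \<bar>q i x - w x\<bar> \<le> 1"
    "\<And>i. i \<ge> N \<Longrightarrow> \<bar>X i - t\<bar> < 1"
    unfolding eventually_sequentially by blast
  let ?d = "\<lambda>i x. (\<psi> (u (X i) x) - \<psi> (u t x)) / (X i - t)"
  \<comment> \<open>The bounds hold only from N on. The shift by N gives a majorant for every index,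
    and \<open>LIMSEQ_offset\<close> undoes it at the end.\<close>
  have bound: "AE x in ?M. norm (?d (i + N) x) \<le> B * (W + 1)" for i
    using R(2) W(2) N(1)[of "i + N", simplified]
  proof eventually_elim
    case (elim x)
    let ?i = "i + N"
    have qb: "\<bar>q ?i x\<bar> \<le> W + 1" using elim by linarith
    have "\<bar>(X ?i - t) * q ?i x\<bar> \<le> 1 * (W + 1)"
      unfolding abs_mult using N(2)[of ?i] qb by (intro mult_mono) auto
    then have "\<bar>u (X ?i) x\<bar> \<le> R + (W + 1)"
      unfolding uX using elim abs_triangle_ineq[of "u t x" "(X ?i - t) * q ?i x"] by simp
    then have "\<bar>\<psi> (u (X ?i) x) - \<psi> (u t x)\<bar> \<le> B * \<bar>u (X ?i) x - u t x\<bar>"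
      using elim W(1) by (intro B(2)) auto
    then have "norm (?d ?i x) \<le> B * \<bar>q ?i x\<bar>"
      using Xt[of ?i] by (simp add: q_def abs_divide divide_right_mono)
    also have "\<dots> \<le> B * (W + 1)" using qb B(1) by (intro mult_left_mono)
    finally show ?case .
  qed
  have ptw: "AE x in ?M. (\<lambda>i. ?d i x) \<longlonglongrightarrow> \<psi>' (u t x) * w x"
    using q1
  proof eventually_elim
    case (elim x)
    \<comment> \<open>Caratheodory's form of the derivative avoids dividing by
      \<open>u (X i) x - u t x\<close>, which may vanish.\<close>
    obtain k where k: "\<And>z. \<psi> z - \<psi> (u t x) = k z * (z - u t x)" "isCont k (u t x)"
      "k (u t x) = \<psi>' (u t x)"
      using \<psi>[of "u t x"] unfolding CARAT_DERIV by auto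
    have "(\<lambda>i. u t x + (X i - t) * q i x) \<longlonglongrightarrow> u t x + (t - t) * w x"
      by (intro tendsto_intros X elim)
    then have "(\<lambda>i. k (u (X i) x)) \<longlonglongrightarrow> k (u t x)"
      unfolding uX[symmetric] by (intro isCont_tendsto_compose[OF k(2)]) simp
    then have "(\<lambda>i. k (u (X i) x) * q i x) \<longlonglongrightarrow> \<psi>' (u t x) * w x"
      using elim k(3) by (auto intro!: tendsto_mult)
    then show ?case by (simp add: k(1) q_def)
  qed
  have intg: "integrable ?M (\<lambda>x. \<psi> (u s x))" if s: "s \<in> I" for s
  proof -
    obtain S where S: "0 \<le> S" "AE x in ?M. \<bar>u s x\<bar> \<le> S" by (rule Linf_AE_bounded[OF u[OF s]])
    show ?thesis by (rule integrable_continuous_comp[OF \<Omega> c\<psi> meas(1)[OF s] S(2)])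
  qed
  have "(\<lambda>i. LINT x|?M. ?d (i + N) x) \<longlonglongrightarrow> (LINT x|?M. \<psi>' (u t x) * w x)"
  proof (rule integral_dominated_convergence[where w = "\<lambda>_. B * (W + 1)"])
    show "(\<lambda>x. \<psi>' (u t x) * w x) \<in> borel_measurable ?M"
      by (intro borel_measurable_times continuous_comp_measurable[OF \<psi>'] meas t)
    show "?d (i + N) \<in> borel_measurable ?M" for i
      using X(1) t by (intro borel_measurable_divide borel_measurable_diff
        continuous_comp_measurable[OF c\<psi>] meas borel_measurable_const) auto
    show "AE x in ?M. (\<lambda>i. ?d (i + N) x) \<longlonglongrightarrow> \<psi>' (u t x) * w x"
      using ptw by eventually_elim (rule LIMSEQ_ignore_initial_segment)
  qed (use bound in auto)
  then have "(\<lambda>i. LINT x|?M. ?d i x) \<longlonglongrightarrow> (LINT x|?M. \<psi>' (u t x) * w x)"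
    by (rule LIMSEQ_offset)
  moreover have "(LINT x|?M. ?d i x)
      = ((LINT x|?M. \<psi> (u (X i) x)) - (LINT x|?M. \<psi> (u t x))) / (X i - t)" for i
    using X(1) t intg by (simp add: Bochner_Integration.integral_diff)
  ultimately show "(\<lambda>i. ((LINT x|?M. \<psi> (u (X i) x)) - (LINT x|?M. \<psi> (u t x))) / (X i - t))
      \<longlonglongrightarrow> (LINT x|?M. \<psi>' (u t x) * w x)"
    by (simp only:)
qed

text \<open>For s close to t the quotient is within 1 of w in norm, so the radius R + (W + 1) bounds
  u(s) for all s in a whole neighbourhood. The exceptional null set may depend on s, the radius does
  not.\<close>

lemma has_Linf_derivative_locally_bounded:
  assumes u: "u t \<in> Linf \<Omega>" and der: "has_Linf_derivative \<Omega> u w t I"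
  obtains d R where "0 < d" "\<And>s. s \<in> I \<Longrightarrow> \<bar>s - t\<bar> < d \<Longrightarrow> AE x in lebesgue_on \<Omega>. \<bar>u s x\<bar> \<le> R"
proof -
  let ?M = "lebesgue_on \<Omega>"
  have w: "w \<in> Linf \<Omega>"
    and lim: "((\<lambda>s. Linf_norm \<Omega> (\<lambda>x. (u s x - u t x) / (s - t) - w x)) \<longlongrightarrow> 0) (at t within I)"
    using der by (auto simp: has_Linf_derivative_def)
  obtain R where R: "0 \<le> R" "AE x in ?M. \<bar>u t x\<bar> \<le> R" by (rule Linf_AE_bounded[OF u])
  obtain W where W: "0 \<le> W" "AE x in ?M. \<bar>w x\<bar> \<le> W" by (rule Linf_AE_bounded[OF w])
  have "\<forall>\<^sub>F s in at t within I. Linf_norm \<Omega> (\<lambda>x. (u s x - u t x) / (s - t) - w x) < 1"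
    using lim by (rule order_tendstoD) simp
  then obtain d where d: "0 < d"
    "\<And>s. s \<in> I \<Longrightarrow> s \<noteq> t \<Longrightarrow> dist s t < d \<Longrightarrow> Linf_norm \<Omega> (\<lambda>x. (u s x - u t x) / (s - t) - w x) < 1"
    unfolding eventually_at by blast
  have "AE x in ?M. \<bar>u s x\<bar> \<le> R + (W + 1)" if s: "s \<in> I" "\<bar>s - t\<bar> < min d 1" for s
  proof (cases "s = t")
    case True
    show ?thesis using R(2) by eventually_elim (use True W(1) in auto)
  next
    case False
    have "AE x in ?M. ennreal \<bar>(u s x - u t x) / (s - t) - w x\<bar>
        \<le> Linf_norm \<Omega> (\<lambda>x. (u s x - u t x) / (s - t) - w x)"
      unfolding Linf_norm_def by (rule esssup_AE)
    then show ?thesis using R(2) W(2)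
    proof eventually_elim
      case (elim x)
      define q where "q = (u s x - u t x) / (s - t)"
      have "ennreal \<bar>q - w x\<bar> \<le> ennreal 1"
        using order_trans[OF elim(1) less_imp_le[OF d(2)]] s False by (simp add: q_def dist_real_def)
      then have "\<bar>q - w x\<bar> \<le> 1" by (subst (asm) ennreal_le_iff) auto
      then have "\<bar>(s - t) * q\<bar> \<le> 1 * (W + 1)"
        unfolding abs_mult using s(2) elim by (intro mult_mono) auto
      moreover have "u s x = u t x + (s - t) * q" using False by (simp add: q_def)
      ultimately show ?case
        using elim(2) abs_triangle_ineq[of "u t x" "(s - t) * q"] by simp
    qed
  qed
  then show thesis using d(1) by (intro that[of "min d 1" "R + (W + 1)"]) auto
qed

section \<open>Scalar tools: Gronwall, truncated squares, primitives, two-valued functions, monotone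
  limits\<close>

text \<open>The function exp(-Ct) f(t) is nonincreasing. Derivatives are taken within the half-line
  because the flow starts at 0; at interior times they are two-sided, and at the endpoints
  continuity suffices.\<close>

lemma gronwall_zero:
  fixes f f' :: "real \<Rightarrow> real"
  assumes f: "\<And>t. 0 \<le> t \<Longrightarrow> t \<le> T \<Longrightarrow> (f has_real_derivative f' t) (at t within {0..})"
    and "\<And>t. 0 \<le> t \<Longrightarrow> t \<le> T \<Longrightarrow> f' t \<le> C * f t" and "f 0 = 0" and "0 \<le> T"
  shows "f T \<le> 0"
proof -
  have "exp (- C * T) * f T \<le> exp (- C * 0) * f 0"
  proof (rule DERIV_nonpos_imp_decreasing_open[OF \<open>0 \<le> T\<close>])
    fix t assume t: "0 < t" "t < T"
    have "(f has_real_derivative f' t) (at t within {0..})" using f t by auto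
    then have "(f has_real_derivative f' t) (at t)"
      using t by (simp add: at_within_interior[of t "{0..}"])
    then have "((\<lambda>t. exp (- C * t) * f t) has_real_derivative exp (- C * t) * (f' t - C * f t)) (at t)"
      by (auto intro!: derivative_eq_intros simp: algebra_simps)
    moreover have "exp (- C * t) * (f' t - C * f t) \<le> 0"
      using assms(2)[of t] t by (intro mult_nonneg_nonpos) auto
    ultimately show "\<exists>y. ((\<lambda>t. exp (- C * t) * f t) has_real_derivative y) (at t) \<and> y \<le> 0" by blast
  next
    have "continuous_on {0..T} f"
      by (rule DERIV_continuous_on[of _ _ f'])
         (auto intro!: DERIV_subset[OF f])
    then show "continuous_on {0..T} (\<lambda>t. exp (- C * t) * f t)"
      by (intro continuous_intros)
  qed
  then show ?thesis using \<open>f 0 = 0\<close> by (simp add: mult_le_0_iff)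
qed

text \<open>Squaring removes the kink of the positive part. With \<sigma> = 1 the function penalises
  values above a, with \<sigma> = -1 values below a, so upper and lower barriers share one
  proof.\<close>

lemma has_real_derivative_max_square:
  fixes \<sigma> a s :: real
  shows "((\<lambda>s. (max 0 (\<sigma> * (s - a)))\<^sup>2) has_real_derivative 2 * \<sigma> * max 0 (\<sigma> * (s - a))) (at s)"
proof -
  have sq: "((\<lambda>y. (max 0 y)\<^sup>2) has_real_derivative 2 * max 0 y) (at y)" for y :: real
  proof -
    consider "y < 0" | "y = 0" | "0 < y" by linarith
    then show ?thesis
    proof cases
      case 1
      have "((\<lambda>y. 0) has_real_derivative 0) (at y)" by simp
      then have "((\<lambda>y. (max 0 y)\<^sup>2) has_real_derivative 0) (at y)"
        by (rule has_field_derivative_transform_within_open[of _ _ _ "{..<0}"]) (use 1 in auto)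
      then show ?thesis using 1 by simp
    next
      case 2
      \<comment> \<open>At the kink the Caratheodory slope is \<open>max 0 z\<close>, since the
        square of \<open>max 0 z\<close> equals \<open>max 0 z * z\<close>.\<close>
      have "\<exists>k. (\<forall>z. (max 0 z)\<^sup>2 - (max 0 0)\<^sup>2 = k z * (z - 0)) \<and> isCont k 0 \<and> k 0 = (0::real)"
      proof (intro exI conjI)
        show "isCont (\<lambda>z::real. max 0 z) 0" by (intro continuous_max continuous_intros)
      qed (auto simp: max_def power2_eq_square)
      then have "((\<lambda>y. (max 0 y)\<^sup>2) has_real_derivative 0) (at (0::real))"
        unfolding CARAT_DERIV .
      then show ?thesis using 2 by simp
    next
      case 3
      have "((\<lambda>y. y\<^sup>2) has_real_derivative 2 * y) (at y)"
        by (auto intro!: derivative_eq_intros)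
      then have "((\<lambda>y. (max 0 y)\<^sup>2) has_real_derivative 2 * y) (at y)"
        by (rule has_field_derivative_transform_within_open[of _ _ _ "{0<..}"]) (use 3 in auto)
      then show ?thesis using 3 by simp
    qed
  qed
  have "((\<lambda>s. \<sigma> * (s - a)) has_real_derivative \<sigma>) (at s)"
    by (auto intro!: derivative_eq_intros)
  from DERIV_chain2[OF sq this] show ?thesis by (simp add: mult_ac)
qed


lemma has_real_derivative_primitive:
  assumes "continuous_on UNIV p"
  shows "(primitive p has_real_derivative p s) (at s)"
proof -
  \<comment> \<open>The interval contains the base point 0, and it has s in its interior, so the
    derivative within it is the full derivative.\<close>
  have "((\<lambda>y. interval_lebesgue_integral lborel (ereal 0) (ereal y) p) has_vector_derivative p s)
      (at s within {- \<bar>s\<bar> - 1..\<bar>s\<bar> + 1})"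
    by (rule interval_integral_FTC2) (auto intro: continuous_on_subset[OF assms])
  moreover have "at s within {- \<bar>s\<bar> - 1..\<bar>s\<bar> + 1} = at s"
    by (rule at_within_Icc_at) auto
  ultimately show ?thesis
    unfolding primitive_def[abs_def] has_real_derivative_iff_has_vector_derivative by (simp only:)
qed

lemma primitive_0 [simp]: "primitive p 0 = 0"
  by (simp add: primitive_def)

text \<open>The condition f(0) = 0 removes the contribution of the part of \<Omega> outside A and B.
  With B the complement of A, or B empty, the same formula covers all three representations of
  \<phi>.\<close>

lemma integral_comp_two_valued:
  fixes f :: "real \<Rightarrow> real"
  assumes \<Omega>: "\<Omega> \<in> lmeasurable" and A: "A \<in> sets lebesgue" "A \<subseteq> \<Omega>" and B: "B \<in> sets lebesgue" "B \<subseteq> \<Omega>"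
    and "A \<inter> B = {}" and f: "continuous_on UNIV f" "f 0 = 0"
    and \<phi>: "\<phi> \<in> borel_measurable (lebesgue_on \<Omega>)"
      "AE x in lebesgue_on \<Omega>. \<phi> x = a * indicator A x + b * indicator B x"
  shows "(LINT x|lebesgue_on \<Omega>. f (\<phi> x)) = f a * measure lebesgue A + f b * measure lebesgue B"
proof -
  let ?M = "lebesgue_on \<Omega>"
  interpret finite_measure ?M by (rule finite_measure_lebesgue_on[OF \<Omega>])
  have \<Omega>': "\<Omega> \<in> sets lebesgue" using \<Omega> by auto
  have S: "A \<in> sets ?M" "B \<in> sets ?M" using A B \<Omega>' by (auto simp: sets_restrict_space_iff)
  have m: "measure ?M A = measure lebesgue A" "measure ?M B = measure lebesgue B"
    using A B \<Omega>' by (auto simp: measure_restrict_space)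
  have int: "integrable ?M (\<lambda>x. c * indicator C x :: real)" if "C \<in> sets ?M" for C c
    using that by (intro integrable_mult_right) (auto simp: less_top[symmetric])
  have "(LINT x|?M. f (\<phi> x)) = (LINT x|?M. f a * indicator A x + f b * indicator B x)"
  proof (rule integral_cong_AE)
    show "AE x in ?M. f (\<phi> x) = f a * indicator A x + f b * indicator B x"
      using \<phi>(2) by eventually_elim (use \<open>A \<inter> B = {}\<close> f(2) in \<open>auto simp: indicator_def\<close>)
  qed (use S in \<open>auto intro: continuous_comp_measurable[OF f(1) \<phi>(1)]\<close>)
  also have "\<dots> = f a * measure ?M A + f b * measure ?M B"
    using S sets.sets_into_space[of _ ?M] int by (simp add: Int_absorb2)
  finally show ?thesis by (simp add: m)
qed

text \<open>L bounds f from above because the sequence eventually passes every time t; one index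
  with value above L - e then controls all later times. Convergence is part of the conclusion, so
  the \<open>Lim\<close> in \<open>energy_limit\<close> becomes a genuine limit.\<close>

lemma monotone_tendsto_at_top_of_subsequence:
  fixes f :: "real \<Rightarrow> real"
  assumes mono: "\<And>s t. 0 \<le> s \<Longrightarrow> s \<le> t \<Longrightarrow> f s \<le> f t"
    and X: "\<And>n. 0 \<le> X n" "filterlim X at_top sequentially" "(\<lambda>n. f (X n)) \<longlonglongrightarrow> L"
  shows "(f \<longlongrightarrow> L) at_top"
proof (rule tendstoI)
  fix e :: real assume "0 < e"
  have upper: "f t \<le> L" if "0 \<le> t" for t
  proof (rule tendsto_lowerbound[OF X(3)])
    have "\<forall>\<^sub>F n in sequentially. t \<le> X n"
      using X(2) unfolding filterlim_at_top by blast
    then show "\<forall>\<^sub>F n in sequentially. f t \<le> f (X n)"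
      by (rule eventually_mono) (rule mono[OF that])
  qed simp
  have "\<forall>\<^sub>F n in sequentially. L - e < f (X n)"
    using X(3) by (rule order_tendstoD) (use \<open>0 < e\<close> in simp)
  then obtain n where n: "L - e < f (X n)" by (auto simp: eventually_sequentially)
  have "dist (f t) L < e" if "t \<ge> X n" for t
    using mono[OF X(1) that] upper[of t] n X(1)[of n] that by (simp add: dist_real_def)
  then show "\<forall>\<^sub>F t in at_top. dist (f t) L < e"
    unfolding eventually_at_top_linorder by blast
qed

section \<open>The solution: regularity in time and conservation of mass\<close>

text \<open>This setting is common to the three ranges of initial data. Zeros and sign of g enter
  lemma by lemma; where \<sigma> * g(u) >= 0 is assumed with \<sigma> = 1 or -1, one argument treats
  both signs of g(u).\<close>

locale nonlocal_solution =
  fixes \<Omega> :: "'a::euclidean_space set" and p p' g g' :: "real \<Rightarrow> real"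
    and u\<^sub>0 :: "'a \<Rightarrow> real" and u :: "real \<Rightarrow> 'a \<Rightarrow> real"
  assumes \<Omega>: "\<Omega> \<in> lmeasurable"
    and p: "\<And>s. (p has_real_derivative p' s) (at s)" "continuous_on UNIV p'" "mono p"
    and g: "\<And>s. (g has_real_derivative g' s) (at s)" "continuous_on UNIV g'"
    and u\<^sub>0: "u\<^sub>0 \<in> Linf \<Omega>"
    and sol: "solution_P \<Omega> p g u\<^sub>0 \<infinity> u"
begin

abbreviation M where "M \<equiv> lebesgue_on \<Omega>"

definition lam :: "real \<Rightarrow> real" where
  "lam t = (LINT x|M. g (u t x) * p (u t x)) / (LINT x|M. g (u t x))"

sublocale finite_measure M by (rule finite_measure_lebesgue_on[OF \<Omega>])

lemma cont_p: "continuous_on UNIV p" and cont_g: "continuous_on UNIV g"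
  by (rule DERIV_continuous_on, rule p(1) g(1))+

lemma u_Linf: "0 \<le> t \<Longrightarrow> u t \<in> Linf \<Omega>"
  and u_init: "AE x in M. u 0 x = u\<^sub>0 x"
  and int_g_nonzero: "0 \<le> t \<Longrightarrow> (LINT x|M. g (u t x)) \<noteq> 0"
  and u_deriv: "0 \<le> t \<Longrightarrow>
        has_Linf_derivative \<Omega> u (\<lambda>x. g (u t x) * (p (u t x) - lam t)) t {0..}"
proof -
  have I: "{t. 0 \<le> t \<and> ereal t < \<infinity>} = {0..}" by auto
  note * = sol[unfolded solution_P_def Let_def I]
  show "0 \<le> t \<Longrightarrow> u t \<in> Linf \<Omega>" using * by (auto simp: C1_Linf_def)
  show "AE x in M. u 0 x = u\<^sub>0 x" using * by blast
  show "0 \<le> t \<Longrightarrow> (LINT x|M. g (u t x)) \<noteq> 0" using * by auto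
  have "nonlocal_F \<Omega> p g (u t) = (\<lambda>x. g (u t x) * (p (u t x) - lam t))"
    unfolding nonlocal_F_def lam_def by (simp add: right_diff_distrib)
  moreover have "0 \<le> t \<Longrightarrow> has_Linf_derivative \<Omega> u (nonlocal_F \<Omega> p g (u t)) t {0..}"
    using * by auto
  ultimately show "0 \<le> t \<Longrightarrow>
        has_Linf_derivative \<Omega> u (\<lambda>x. g (u t x) * (p (u t x) - lam t)) t {0..}"
    by (simp only:)
qed

lemma u_meas: "0 \<le> t \<Longrightarrow> u t \<in> borel_measurable M"
  by (rule Linf_measurable[OF u_Linf])

lemma integrable_u:
  fixes \<psi> :: "real \<Rightarrow> real"
  assumes "0 \<le> t" "continuous_on UNIV \<psi>"
  shows "integrable M (\<lambda>x. \<psi> (u t x))"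
proof -
  obtain R where R: "0 \<le> R" "AE x in M. \<bar>u t x\<bar> \<le> R"
    by (rule Linf_AE_bounded[OF u_Linf[OF assms(1)]])
  show ?thesis by (rule integrable_continuous_comp[OF \<Omega> assms(2) u_meas[OF assms(1)] R(2)])
qed

lemma deriv_integral:
  fixes \<psi> \<psi>' :: "real \<Rightarrow> real"
  assumes "0 \<le> t" "\<And>s. (\<psi> has_real_derivative \<psi>' s) (at s)" "continuous_on UNIV \<psi>'"
  shows "((\<lambda>s. LINT x|M. \<psi> (u s x)) has_real_derivative
            (LINT x|M. \<psi>' (u t x) * (g (u t x) * (p (u t x) - lam t)))) (at t within {0..})"
  using has_Linf_derivative_integral_comp[OF \<Omega> _ _ u_deriv[OF assms(1)] assms(2,3)]
    u_Linf assms(1) by simp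

lemma continuous_on_integral:
  fixes \<psi> \<psi>' :: "real \<Rightarrow> real"
  assumes "\<And>s. (\<psi> has_real_derivative \<psi>' s) (at s)" "continuous_on UNIV \<psi>'"
  shows "continuous_on {0..} (\<lambda>t. LINT x|M. \<psi> (u t x))"
  by (rule DERIV_continuous_on[OF deriv_integral[OF _ assms]]) simp

text \<open>\<open>lam t\<close> is exactly the constant that gives the right-hand side mean zero.
  Besides conservation of mass, this allows a constant to be subtracted from \<psi>' in the
  derivative of a convex functional.\<close>

lemma integral_F_zero:
  assumes "0 \<le> t"
  shows "(LINT x|M. g (u t x) * (p (u t x) - lam t)) = 0"
proof -
  have "integrable M (\<lambda>x. g (u t x) * p (u t x))"
    by (rule integrable_u[OF assms, of "\<lambda>s. g s * p s"]) (intro continuous_intros cont_p cont_g)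
  moreover have "integrable M (\<lambda>x. g (u t x) * lam t)"
    by (rule integrable_u[OF assms, of "\<lambda>s. g s * lam t"]) (intro continuous_intros cont_g)
  ultimately have "(LINT x|M. g (u t x) * (p (u t x) - lam t))
      = (LINT x|M. g (u t x) * p (u t x)) - (LINT x|M. g (u t x)) * lam t"
    by (simp add: right_diff_distrib)
  then show ?thesis using int_g_nonzero[OF assms] by (simp add: lam_def)
qed

lemma mass_conserved:
  assumes "0 \<le> T"
  shows "(LINT x|M. u T x) = (LINT x|M. u\<^sub>0 x)"
proof -
  let ?m = "\<lambda>t. LINT x|M. u t x"
  have d: "(?m has_real_derivative 0) (at t within {0..})" if "0 \<le> t" for t
    using deriv_integral[OF that, of "\<lambda>s. s" "\<lambda>s. 1"] integral_F_zero[OF that] by simp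
  have "?m T = ?m 0"
    using has_field_derivative_zero_constant[of "{0..}" ?m] d assms by fastforce
  also have "\<dots> = (LINT x|M. u\<^sub>0 x)"
    using u_init by (intro integral_cong_AE) (use u_meas[of 0] Linf_measurable[OF u\<^sub>0] in auto)
  finally show ?thesis .
qed

section \<open>Bounds on finite time intervals and invariant half-lines\<close>

text \<open>Local bounds around each time are patched together by bisection. The radius may still
  grow with T, which is harmless for Gronwall on [0,T].\<close>

lemma bounded_on_interval:
  assumes "0 \<le> T"
  obtains R where "0 \<le> R" "\<And>s. 0 \<le> s \<Longrightarrow> s \<le> T \<Longrightarrow> AE x in M. \<bar>u s x\<bar> \<le> R"
proof -
  \<comment> \<open>The intersection with the half-line is needed because the local step of
    \<open>Bolzano\<close> also tests intervals that reach below 0.\<close>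
  define P where "P a b \<longleftrightarrow> (\<exists>R. \<forall>s\<in>{a..b} \<inter> {0..}. AE x in M. \<bar>u s x\<bar> \<le> R)" for a b
  have "P 0 T" using assms
  proof (induct rule: Bolzano)
    case (trans a b c)
    then obtain R S where "\<forall>s\<in>{a..b} \<inter> {0..}. AE x in M. \<bar>u s x\<bar> \<le> R"
      "\<forall>s\<in>{b..c} \<inter> {0..}. AE x in M. \<bar>u s x\<bar> \<le> S" unfolding P_def by blast
    then have "AE x in M. \<bar>u s x\<bar> \<le> max R S" if "s \<in> {a..c} \<inter> {0..}" for s
      using that by (cases "s \<le> b") (auto elim!: eventually_mono simp: le_max_iff_disj)
    then show ?case unfolding P_def by blast
  next
    case (local t)
    obtain d R where d: "0 < d" "\<And>s. s \<in> {0..} \<Longrightarrow> \<bar>s - t\<bar> < d \<Longrightarrow> AE x in M. \<bar>u s x\<bar> \<le> R"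
      by (rule has_Linf_derivative_locally_bounded[OF u_Linf u_deriv]) (use local in auto)
    have "P a b" if "a \<le> t" "t \<le> b" "b - a < d" for a b
      unfolding P_def using that d(2) by (intro exI[of _ R]) auto
    then show ?case using d(1) by blast
  qed
  then obtain R where R: "\<forall>s\<in>{0..T} \<inter> {0..}. AE x in M. \<bar>u s x\<bar> \<le> R" unfolding P_def by blast
  then have "AE x in M. \<bar>u s x\<bar> \<le> max 0 R" if "0 \<le> s" "s \<le> T" for s
    using that by (auto elim!: eventually_mono simp: le_max_iff_disj)
  then show thesis by (intro that[of "max 0 R"]) auto
qed

text \<open>Numerator and denominator are continuous in time and the denominator never vanishes, so
  the quotient is bounded on the compact interval. The denominator could approach 0 as time grows,
  hence the finite horizon.\<close>

lemma lam_bounded: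
  obtains L where "0 \<le> L" "\<And>t. 0 \<le> t \<Longrightarrow> t \<le> T \<Longrightarrow> \<bar>lam t\<bar> \<le> L"
proof -
  have "continuous_on {0..} (\<lambda>t. LINT x|M. g (u t x) * p (u t x))"
  proof (rule continuous_on_integral[of "\<lambda>s. g s * p s" "\<lambda>s. g' s * p s + p' s * g s"])
    show "((\<lambda>s. g s * p s) has_real_derivative g' s * p s + p' s * g s) (at s)" for s
      by (rule DERIV_mult[OF g(1) p(1)])
    show "continuous_on UNIV (\<lambda>s. g' s * p s + p' s * g s)"
      by (intro continuous_intros p g cont_p cont_g)
  qed
  moreover have "continuous_on {0..} (\<lambda>t. LINT x|M. g (u t x))"
    by (rule continuous_on_integral[OF g])
  ultimately have "continuous_on {0..T} lam"
    unfolding lam_def using int_g_nonzero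
    by (intro continuous_on_subset[of "{0..}" _ "{0..T}"] continuous_on_divide) auto
  then have "bounded (lam ` {0..T})"
    by (intro compact_imp_bounded compact_continuous_image) auto
  then obtain L where "0 < L" "\<And>t. t \<in> {0..T} \<Longrightarrow> norm (lam t) \<le> L"
    unfolding bounded_pos by auto
  then show thesis using that[of L] by auto
qed

lemma AE_le_of_integral_max_square:
  assumes "0 \<le> t" "(LINT x|M. (max 0 (\<sigma> * (u t x - a)))\<^sup>2) \<le> 0"
  shows "AE x in M. \<sigma> * (u t x - a) \<le> 0"
proof -
  have i: "integrable M (\<lambda>x. (max 0 (\<sigma> * (u t x - a)))\<^sup>2)"
    by (rule integrable_u[OF assms(1), of "\<lambda>s. (max 0 (\<sigma> * (s - a)))\<^sup>2"]) (intro continuous_intros)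
  have "(LINT x|M. (max 0 (\<sigma> * (u t x - a)))\<^sup>2) = 0"
    by (rule antisym[OF assms(2)]) (rule integral_nonneg_AE, simp)
  then have "AE x in M. (max 0 (\<sigma> * (u t x - a)))\<^sup>2 = 0"
    using integral_nonneg_eq_0_iff_AE[OF i] by simp
  then show ?thesis by eventually_elim (auto simp: max_def split: if_splits)
qed

lemma integral_max_square_init:
  assumes "AE x in M. \<sigma> * (u\<^sub>0 x - a) \<le> 0"
  shows "(LINT x|M. (max 0 (\<sigma> * (u 0 x - a)))\<^sup>2) = 0"
  using u_init assms by (intro integral_eq_zero_AE) (auto elim: eventually_elim2)

text \<open>Since g(a) = 0, |g(u)| is at most a constant times |u - a|, and the time derivative of
  the integrated truncated square is at most a multiple of that integral. It starts at 0, so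
  Gronwall keeps it there.\<close>

lemma barrier:
  assumes "g a = 0" "\<bar>\<sigma>\<bar> = 1" "AE x in M. \<sigma> * (u\<^sub>0 x - a) \<le> 0" "0 \<le> T"
  shows "AE x in M. \<sigma> * (u T x - a) \<le> 0"
proof -
  define \<psi> where "\<psi> s = (max 0 (\<sigma> * (s - a)))\<^sup>2" for s
  define \<psi>' where "\<psi>' s = 2 * \<sigma> * max 0 (\<sigma> * (s - a))" for s
  have \<psi>: "(\<psi> has_real_derivative \<psi>' s) (at s)" for s
    unfolding \<psi>_def[abs_def] \<psi>'_def by (rule has_real_derivative_max_square)
  have c: "continuous_on UNIV \<psi>'" "continuous_on UNIV \<psi>"
    unfolding \<psi>'_def \<psi>_def by (intro continuous_intros)+
  obtain R where R: "0 \<le> R" "\<And>s. 0 \<le> s \<Longrightarrow> s \<le> T \<Longrightarrow> AE x in M. \<bar>u s x\<bar> \<le> R"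
    by (rule bounded_on_interval[OF assms(4)]) blast
  obtain L where L: "0 \<le> L" "\<And>t. 0 \<le> t \<Longrightarrow> t \<le> T \<Longrightarrow> \<bar>lam t\<bar> \<le> L"
    by (rule lam_bounded) blast
  \<comment> \<open>The ball must contain the range of u and also the zero a, because g is compared
    with g(a).\<close>
  obtain G where G: "0 \<le> G"
    "\<And>x y. \<bar>x\<bar> \<le> max R \<bar>a\<bar> \<Longrightarrow> \<bar>y\<bar> \<le> max R \<bar>a\<bar> \<Longrightarrow> \<bar>g x - g y\<bar> \<le> G * \<bar>x - y\<bar>"
    by (rule C1_lipschitz_on_bounded[OF g, of "max R \<bar>a\<bar>"]) blast
  obtain B where B: "0 \<le> B" "\<And>s. \<bar>s\<bar> \<le> R \<Longrightarrow> \<bar>p s\<bar> \<le> B"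
    by (rule continuous_bounded_on_abs_le[OF cont_p]) blast
  have "(LINT x|M. \<psi> (u T x)) \<le> 0"
  proof (rule gronwall_zero[OF deriv_integral[OF _ \<psi> c(1)] _ _ assms(4)])
    show "(LINT x|M. \<psi> (u 0 x)) = 0"
      unfolding \<psi>_def by (rule integral_max_square_init[OF assms(3)])
  next
    fix t assume t: "0 \<le> t" "t \<le> T"
    have i1: "integrable M (\<lambda>x. \<psi>' (u t x) * (g (u t x) * (p (u t x) - lam t)))"
      by (rule integrable_u[OF t(1), of "\<lambda>s. \<psi>' s * (g s * (p s - lam t))"])
         (intro continuous_intros c cont_p cont_g)
    have i2: "integrable M (\<lambda>x. 2 * G * (B + L) * \<psi> (u t x))"
      by (intro integrable_mult_right integrable_u t c)
    have "AE x in M. \<psi>' (u t x) * (g (u t x) * (p (u t x) - lam t)) \<le> 2 * G * (B + L) * \<psi> (u t x)"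
      using R(2)[OF t]
    proof eventually_elim
      case (elim x)
      define s where "s = u t x"
      define m where "m = max 0 (\<sigma> * (s - a))"
      have s: "\<bar>s\<bar> \<le> R" using elim by (simp add: s_def)
      have "\<bar>g s\<bar> \<le> G * \<bar>s - a\<bar>" using G(2)[of s a] s assms(1) by simp
      moreover have "\<bar>p s - lam t\<bar> \<le> B + L" using B(2)[OF s] L(2)[OF t] by linarith
      ultimately have "\<bar>g s\<bar> * \<bar>p s - lam t\<bar> \<le> (G * \<bar>s - a\<bar>) * (B + L)"
        using G(1) by (intro mult_mono) auto
      then have "2 * m * (\<bar>g s\<bar> * \<bar>p s - lam t\<bar>) \<le> 2 * m * ((G * \<bar>s - a\<bar>) * (B + L))"
        by (intro mult_left_mono) (auto simp: m_def)
      also have "\<dots> = 2 * G * (B + L) * (m * \<bar>s - a\<bar>)" by simp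
      \<comment> \<open>Either s lies on the allowed side and m = 0, or m is the full distance from
        s to a.\<close>
      also have "m * \<bar>s - a\<bar> = m\<^sup>2"
      proof (cases "m = 0")
        case False
        moreover have "0 \<le> m" by (simp add: m_def)
        ultimately have "0 < m" by simp
        moreover from this have "m = \<sigma> * (s - a)" by (simp add: m_def max_def split: if_splits)
        ultimately have "m = \<bar>s - a\<bar>" using assms(2) by (metis abs_mult abs_of_pos mult_1)
        then show ?thesis by (simp add: power2_eq_square)
      qed simp
      finally have "2 * m * (\<bar>g s\<bar> * \<bar>p s - lam t\<bar>) \<le> 2 * G * (B + L) * m\<^sup>2" .
      moreover have "\<bar>2 * \<sigma> * m * (g s * (p s - lam t))\<bar> = 2 * m * (\<bar>g s\<bar> * \<bar>p s - lam t\<bar>)"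
        using assms(2) by (simp add: abs_mult m_def)
      ultimately show ?case unfolding \<psi>_def \<psi>'_def s_def[symmetric] m_def[symmetric] by linarith
    qed
    from integral_mono_AE[OF i1 i2 this]
    show "(LINT x|M. \<psi>' (u t x) * (g (u t x) * (p (u t x) - lam t)))
        \<le> 2 * G * (B + L) * (LINT x|M. \<psi> (u t x))" by simp
  qed
  then show ?thesis unfolding \<psi>_def by (rule AE_le_of_integral_max_square[OF assms(4)])
qed

section \<open>Monotonicity of convex functionals\<close>

text \<open>The weight \<sigma> * g(u) is nonnegative with nonzero integral, so \<open>lam t\<close>
  is a true weighted mean and lies between p(-R) and p(R); the intermediate value theorem gives c.
  This c is the point at which Chebyshev's argument compares \<psi>' and p.\<close>

lemma lam_in_range:
  assumes t: "0 \<le> t" and sign: "AE x in M. 0 \<le> \<sigma> * g (u t x)" and \<sigma>: "\<bar>\<sigma>\<bar> = 1"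
  obtains c where "p c = lam t"
proof -
  obtain R where R: "0 \<le> R" "AE x in M. \<bar>u t x\<bar> \<le> R"
    by (rule Linf_AE_bounded[OF u_Linf[OF t]])
  let ?G = "LINT x|M. \<sigma> * g (u t x)"
  have ig: "integrable M (\<lambda>x. k * (\<sigma> * g (u t x)))" for k
    by (rule integrable_u[OF t, of "\<lambda>s. k * (\<sigma> * g s)"]) (intro continuous_intros cont_g)
  have igp: "integrable M (\<lambda>x. p (u t x) * (\<sigma> * g (u t x)))"
    by (rule integrable_u[OF t, of "\<lambda>s. p s * (\<sigma> * g s)"]) (intro continuous_intros cont_g cont_p)
  have "0 \<le> ?G" by (rule integral_nonneg_AE[OF sign])
  moreover have G: "?G = \<sigma> * (LINT x|M. g (u t x))" by simp
  ultimately have pos: "0 < ?G" using int_g_nonzero[OF t] \<sigma> by (metis abs_zero less_le mult_eq_0_iff zero_neq_one)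
  have "(LINT x|M. p (u t x) * (\<sigma> * g (u t x))) = \<sigma> * (LINT x|M. g (u t x) * p (u t x))"
    by (subst integral_mult_right_zero[symmetric]) (simp add: mult_ac)
  also have "\<dots> = lam t * ?G" using G int_g_nonzero[OF t] by (simp add: lam_def)
  finally have gp: "(LINT x|M. p (u t x) * (\<sigma> * g (u t x))) = lam t * ?G" .
  have kG: "(LINT x|M. k * (\<sigma> * g (u t x))) = k * ?G" for k
    by (rule integral_mult_right_zero)
  have "(LINT x|M. p (u t x) * (\<sigma> * g (u t x))) \<le> (LINT x|M. p R * (\<sigma> * g (u t x)))"
    using igp ig
    by (rule integral_mono_AE) (use sign R(2) in eventually_elim, auto intro!: mult_right_mono monoD[OF p(3)])
  then have hi: "lam t \<le> p R" unfolding gp kG using pos by (rule mult_right_le_imp_le)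
  have "(LINT x|M. p (- R) * (\<sigma> * g (u t x))) \<le> (LINT x|M. p (u t x) * (\<sigma> * g (u t x)))"
    using ig igp
    by (rule integral_mono_AE) (use sign R(2) in eventually_elim, auto intro!: mult_right_mono monoD[OF p(3)])
  then have lo: "p (- R) \<le> lam t" unfolding gp kG using pos by (rule mult_right_le_imp_le)
  show thesis
    using IVT'[OF lo hi _ continuous_on_subset[OF cont_p]] R(1) that by auto
qed

text \<open>Chebyshev's inequality: \<open>\<psi>'\<close> and \<open>p\<close> are both increasing, and \<open>lam t\<close> is the mean of \<open>p (u t)\<close> for
  the weight \<open>\<sigma> * g (u t)\<close>.\<close>

lemma convex_functional_mono:
  fixes \<psi> \<psi>' :: "real \<Rightarrow> real"
  assumes sign: "\<And>t. 0 \<le> t \<Longrightarrow> AE x in M. 0 \<le> \<sigma> * g (u t x)" and \<sigma>: "\<bar>\<sigma>\<bar> = 1"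
    and \<psi>: "\<And>s. (\<psi> has_real_derivative \<psi>' s) (at s)" "continuous_on UNIV \<psi>'" "mono \<psi>'"
    and st: "0 \<le> s" "s \<le> t"
  shows "\<sigma> * (LINT x|M. \<psi> (u s x)) \<le> \<sigma> * (LINT x|M. \<psi> (u t x))"
proof -
  define D where "D r = (LINT x|M. \<psi>' (u r x) * (g (u r x) * (p (u r x) - lam r)))" for r
  have D: "0 \<le> \<sigma> * D r" if r: "0 \<le> r" for r
  proof -
    obtain c where c: "p c = lam r" by (rule lam_in_range[OF r sign[OF r] \<sigma>])
    have i1: "integrable M (\<lambda>x. \<psi>' (u r x) * (g (u r x) * (p (u r x) - lam r)))"
      by (rule integrable_u[OF r, of "\<lambda>s. \<psi>' s * (g s * (p s - lam r))"])
         (intro continuous_intros \<psi> cont_p cont_g)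
    have i2: "integrable M (\<lambda>x. \<psi>' c * (g (u r x) * (p (u r x) - lam r)))"
      by (rule integrable_u[OF r, of "\<lambda>s. \<psi>' c * (g s * (p s - lam r))"])
         (intro continuous_intros cont_p cont_g)
    \<comment> \<open>Subtracting \<psi>'(c) times the vanishing mean of F turns the integrand into
      the weight times (\<psi>'(u) - \<psi>'(c)) (p(u) - p(c)), a product of factors of equal
      sign.\<close>
    have "\<sigma> * D r = \<sigma> * (D r - \<psi>' c * (LINT x|M. g (u r x) * (p (u r x) - lam r)))"
      using integral_F_zero[OF r] by simp
    also have "\<dots> = \<sigma> * (LINT x|M. \<psi>' (u r x) * (g (u r x) * (p (u r x) - lam r))
                       - \<psi>' c * (g (u r x) * (p (u r x) - lam r)))"
      unfolding D_def using i1 i2 by simp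
    also have "\<dots> = (LINT x|M. (\<sigma> * g (u r x)) * ((\<psi>' (u r x) - \<psi>' c) * (p (u r x) - p c)))"
      unfolding c by (subst integral_mult_right_zero[symmetric]) (simp add: algebra_simps)
    also have "\<dots> \<ge> 0"
    proof (rule integral_nonneg_AE, use sign[OF r] in eventually_elim)
      case (elim x)
      have "0 \<le> (\<psi>' y - \<psi>' c) * (p y - p c)" for y
        using monoD[OF \<psi>(3), of y c] monoD[OF \<psi>(3), of c y] monoD[OF p(3), of y c]
          monoD[OF p(3), of c y] by (cases "y \<le> c") (auto intro: mult_nonneg_nonneg mult_nonpos_nonpos)
      then show ?case by (rule mult_nonneg_nonneg[OF elim])
    qed
    finally show ?thesis .
  qed
  let ?f = "\<lambda>r. \<sigma> * (LINT x|M. \<psi> (u r x))"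
  have d: "(?f has_real_derivative \<sigma> * D r) (at r within {0..})" if "0 \<le> r" for r
    unfolding D_def by (intro DERIV_cmult deriv_integral that \<psi>)
  show ?thesis
  proof (rule DERIV_nonneg_imp_increasing_open[OF st(2)])
    fix r assume r: "s < r" "r < t"
    have "(?f has_real_derivative \<sigma> * D r) (at r)"
      using d[of r] r st by (simp add: at_within_interior[of r "{0..}"])
    then show "\<exists>y. (?f has_real_derivative y) (at r) \<and> 0 \<le> y" using D[of r] r st by auto
  next
    show "continuous_on {s..t} ?f"
      by (rule DERIV_continuous_on[of _ _ "\<lambda>r. \<sigma> * D r"])
         (use st in \<open>auto intro!: DERIV_subset[OF d]\<close>)
  qed
qed

text \<open>When g(u) <= 0, convex functionals decrease, and a squared distance that starts at 0
  stays 0. The level a is arbitrary here, in contrast to \<open>barrier\<close>, so the initial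
  bound persists for all times.\<close>

lemma convex_barrier:
  assumes sign: "\<And>t. 0 \<le> t \<Longrightarrow> AE x in M. g (u t x) \<le> 0"
    and \<sigma>: "\<bar>\<sigma>\<bar> = 1" and init: "AE x in M. \<sigma> * (u\<^sub>0 x - a) \<le> 0" and t: "0 \<le> t"
  shows "AE x in M. \<sigma> * (u t x - a) \<le> 0"
proof (rule AE_le_of_integral_max_square[OF t])
  have "mono (\<lambda>s. 2 * \<sigma> * max 0 (\<sigma> * (s - a)))"
    using \<sigma> by (auto intro!: monoI simp: abs_if split: if_splits)
  \<comment> \<open>The factor -1 is the sign of g(u) passed to
    \<open>convex_functional_mono\<close>; the \<sigma> of this lemma only chooses the side of
    a.\<close>
  then have "- 1 * (LINT x|M. (max 0 (\<sigma> * (u 0 x - a)))\<^sup>2) \<le> - 1 * (LINT x|M. (max 0 (\<sigma> * (u t x - a)))\<^sup>2)"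
    using sign t
    by (intro convex_functional_mono[OF _ _ has_real_derivative_max_square])
       (auto intro!: continuous_intros)
  then show "(LINT x|M. (max 0 (\<sigma> * (u t x - a)))\<^sup>2) \<le> 0"
    using integral_max_square_init[OF init] by simp
qed

section \<open>Passage to the limit along the sequence that defines \<phi>\<close>

text \<open>The uniform bound makes \<psi> Lipschitz on all values that occur, so the integrals of
  \<psi> differ by at most a constant times the L1 distance.\<close>

lemma integral_tendsto_omega_limit:
  fixes \<psi> \<psi>' :: "real \<Rightarrow> real"
  assumes \<psi>: "\<And>s. (\<psi> has_real_derivative \<psi>' s) (at s)" "continuous_on UNIV \<psi>'"
    and bound: "\<And>t. 0 \<le> t \<Longrightarrow> AE x in M. \<bar>u t x\<bar> \<le> K"
    and \<phi>: "integrable M \<phi>" "AE x in M. \<bar>\<phi> x\<bar> \<le> K"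
    and X: "\<And>n. 0 \<le> X n" "(\<lambda>n. LINT x|M. \<bar>u (X n) x - \<phi> x\<bar>) \<longlonglongrightarrow> 0"
  shows "(\<lambda>n. LINT x|M. \<psi> (u (X n) x)) \<longlonglongrightarrow> (LINT x|M. \<psi> (\<phi> x))"
proof -
  obtain B where B: "0 \<le> B"
    "\<And>x y. \<bar>x\<bar> \<le> K \<Longrightarrow> \<bar>y\<bar> \<le> K \<Longrightarrow> \<bar>\<psi> x - \<psi> y\<bar> \<le> B * \<bar>x - y\<bar>"
    by (rule C1_lipschitz_on_bounded[OF \<psi>, of K]) blast
  have c: "continuous_on UNIV \<psi>"
    by (rule DERIV_continuous_on) (rule \<psi>(1))
  have i\<phi>: "integrable M (\<lambda>x. \<psi> (\<phi> x))"
    using \<phi>(1) by (intro integrable_continuous_comp[OF \<Omega> c _ \<phi>(2)]) auto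
  have iu: "integrable M (\<lambda>x. \<psi> (u (X n) x))" for n
    by (rule integrable_u[OF X(1) c])
  have le: "norm ((LINT x|M. \<psi> (u (X n) x)) - (LINT x|M. \<psi> (\<phi> x))) \<le> B * (LINT x|M. \<bar>u (X n) x - \<phi> x\<bar>)" for n
  proof -
    have "norm (LINT x|M. \<psi> (u (X n) x) - \<psi> (\<phi> x)) \<le> (LINT x|M. B * \<bar>u (X n) x - \<phi> x\<bar>)"
    proof (rule order_trans[OF integral_norm_bound], rule integral_mono_AE)
      show "integrable M (\<lambda>x. norm (\<psi> (u (X n) x) - \<psi> (\<phi> x)))"
        using iu i\<phi> by (intro integrable_norm Bochner_Integration.integrable_diff)
      show "integrable M (\<lambda>x. B * \<bar>u (X n) x - \<phi> x\<bar>)"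
        using \<phi>(1) integrable_u[OF X(1), of "\<lambda>s. s" n]
        by (intro integrable_mult_right integrable_abs Bochner_Integration.integrable_diff) auto
      show "AE x in M. norm (\<psi> (u (X n) x) - \<psi> (\<phi> x)) \<le> B * \<bar>u (X n) x - \<phi> x\<bar>"
        using bound[OF X(1)[of n]] \<phi>(2) by eventually_elim (simp add: B(2))
    qed
    then show ?thesis using iu i\<phi> by simp
  qed
  have "(\<lambda>n. B * (LINT x|M. \<bar>u (X n) x - \<phi> x\<bar>)) \<longlonglongrightarrow> 0"
    using tendsto_mult_right_zero[OF X(2)] .
  from Lim_null_comparison[OF eventuallyI this, OF le] show ?thesis
    by (rule LIM_zero_cancel)
qed

text \<open>The limit of the integrals along the sequence is computed for two choices of \<psi>. For
  the identity the sequence is constant by conservation of mass; for the primitive of p,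
  monotonicity extends the limit to all times.\<close>

lemma omega_limit_two_valued:
  assumes \<sigma>: "\<bar>\<sigma>\<bar> = 1" and sign: "\<And>t. 0 \<le> t \<Longrightarrow> AE x in M. 0 \<le> \<sigma> * g (u t x)"
    and bound: "\<And>t. 0 \<le> t \<Longrightarrow> AE x in M. \<bar>u t x\<bar> \<le> K"
    and \<phi>: "\<phi> \<in> omega_limit \<Omega> u" "AE x in M. \<phi> x = a * indicator A x + b * indicator B x"
    and A: "A \<in> sets lebesgue" "A \<subseteq> \<Omega>" and B: "B \<in> sets lebesgue" "B \<subseteq> \<Omega>" and AB: "A \<inter> B = {}"
  shows "a * measure lebesgue A + b * measure lebesgue B = (LINT x|M. u\<^sub>0 x)"
    and "((\<lambda>t. LINT x|M. primitive p (u t x)) \<longlongrightarrow>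
          primitive p a * measure lebesgue A + primitive p b * measure lebesgue B) at_top"
proof -
  obtain X where \<phi>': "integrable M \<phi>" and X: "\<And>n. 0 \<le> X n" "filterlim X at_top sequentially"
    "(\<lambda>n. LINT x|M. \<bar>u (X n) x - \<phi> x\<bar>) \<longlonglongrightarrow> 0"
    using \<phi>(1) unfolding omega_limit_def by blast
  \<comment> \<open>The bound on \<phi> is read off from its values a, b and 0, so the common radius
    must cover a and b as well as K.\<close>
  define K' where "K' = max K (\<bar>a\<bar> + \<bar>b\<bar>)"
  have b1: "AE x in M. \<bar>u t x\<bar> \<le> K'" if "0 \<le> t" for t
    using bound[OF that] by eventually_elim (simp add: K'_def)
  have b2: "AE x in M. \<bar>\<phi> x\<bar> \<le> K'"
    using \<phi>(2) by eventually_elim (use AB in \<open>auto simp: K'_def indicator_def\<close>)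
  have lim: "(\<lambda>n. LINT x|M. \<psi> (u (X n) x)) \<longlonglongrightarrow> \<psi> a * measure lebesgue A + \<psi> b * measure lebesgue B"
    if \<psi>: "\<And>s. (\<psi> has_real_derivative \<psi>' s) (at s)" "continuous_on UNIV \<psi>'" "\<psi> 0 = 0" for \<psi> \<psi>'
  proof -
    have "continuous_on UNIV \<psi>"
      by (rule DERIV_continuous_on) (rule \<psi>(1))
    from integral_comp_two_valued[OF \<Omega> A B AB this \<psi>(3) _ \<phi>(2)]
    have "(LINT x|M. \<psi> (\<phi> x)) = \<psi> a * measure lebesgue A + \<psi> b * measure lebesgue B"
      using \<phi>' by auto
    with integral_tendsto_omega_limit[OF \<psi>(1,2) b1 \<phi>' b2 X(1,3)] show ?thesis by simp
  qed
  have "(\<lambda>n. LINT x|M. u (X n) x) \<longlonglongrightarrow> a * measure lebesgue A + b * measure lebesgue B"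
    by (rule lim[of "\<lambda>s. s" "\<lambda>_. 1"]) auto
  then have "(\<lambda>n. LINT x|M. u\<^sub>0 x) \<longlonglongrightarrow> a * measure lebesgue A + b * measure lebesgue B"
    by (simp add: mass_conserved X(1))
  then show "a * measure lebesgue A + b * measure lebesgue B = (LINT x|M. u\<^sub>0 x)"
    by (simp add: LIMSEQ_const_iff)
  let ?E = "\<lambda>t. LINT x|M. primitive p (u t x)"
  let ?L = "primitive p a * measure lebesgue A + primitive p b * measure lebesgue B"
  note P = has_real_derivative_primitive[OF cont_p]
  have "((\<lambda>t. \<sigma> * ?E t) \<longlongrightarrow> \<sigma> * ?L) at_top"
  proof (rule monotone_tendsto_at_top_of_subsequence[OF _ X(1,2)])
    show "\<sigma> * ?E s \<le> \<sigma> * ?E t" if "0 \<le> s" "s \<le> t" for s t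
      by (rule convex_functional_mono[OF sign \<sigma> P cont_p p(3) that])
    show "(\<lambda>n. \<sigma> * ?E (X n)) \<longlonglongrightarrow> \<sigma> * ?L"
      by (intro tendsto_mult_left lim[OF P cont_p primitive_0])
  qed
  \<comment> \<open>A second factor \<sigma> undoes the first, because \<sigma> squared is
    1.\<close>
  then have "((\<lambda>t. \<sigma> * (\<sigma> * ?E t)) \<longlongrightarrow> \<sigma> * (\<sigma> * ?L)) at_top"
    by (rule tendsto_mult_left)
  moreover have "\<sigma> * (\<sigma> * y) = y" for y using \<sigma> by (auto simp: abs_if split: if_splits)
  ultimately show "(?E \<longlongrightarrow> ?L) at_top" by simp
qed

end

section \<open>The three ranges of initial data\<close>

theorem theorem4p5:
  fixes \<Omega> :: "(real ^ 'n) set"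
    and p g :: "real \<Rightarrow> real"
    and u\<^sub>0 \<phi> :: "real ^ 'n \<Rightarrow> real"
    and u :: "real \<Rightarrow> real ^ 'n \<Rightarrow> real"
    and m\<^sub>0 :: real
  assumes "open \<Omega>" and "bounded \<Omega>"
    and "p C1_differentiable_on UNIV" and "strict_mono p"
    and "g C1_differentiable_on UNIV" and "g 0 = 0" and "g 1 = 0"
    and "\<And>s. 0 < s \<Longrightarrow> s < 1 \<Longrightarrow> 0 < g s"
    and "\<And>s. s < 0 \<or> 1 < s \<Longrightarrow> g s < 0"
    and "H1 \<Omega> u\<^sub>0 \<or> H2 \<Omega> g u\<^sub>0 \<or> H3 \<Omega> u\<^sub>0"
    and "solution_P \<Omega> p g u\<^sub>0 \<infinity> u"
    and "\<phi> \<in> omega_limit \<Omega> u"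
    and "m\<^sub>0 = (LINT x|lebesgue_on \<Omega>. u\<^sub>0 x)"
  shows
    "(\<forall>\<mu> A\<^sub>1. H1 \<Omega> u\<^sub>0 \<longrightarrow> 1 < \<mu> \<longrightarrow>
        A\<^sub>1 \<in> sets lebesgue \<longrightarrow> A\<^sub>1 \<subseteq> \<Omega> \<longrightarrow> measure lebesgue A\<^sub>1 \<noteq> 0 \<longrightarrow>
        (AE x in lebesgue_on \<Omega>. \<phi> x = \<mu> * indicator A\<^sub>1 x + indicator (\<Omega> - A\<^sub>1) x) \<longrightarrow>
        \<mu> * measure lebesgue A\<^sub>1 + measure lebesgue \<Omega> - measure lebesgue A\<^sub>1 = m\<^sub>0 \<and>
        primitive p \<mu> * measure lebesgue A\<^sub>1
          + primitive p 1 * (measure lebesgue \<Omega> - measure lebesgue A\<^sub>1)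
          = energy_limit 1 \<Omega> p u) \<and>
     (\<forall>\<nu> A\<^sub>1 A\<^sub>2. H2 \<Omega> g u\<^sub>0 \<longrightarrow> 0 < \<nu> \<longrightarrow> \<nu> < 1 \<longrightarrow>
        A\<^sub>1 \<in> sets lebesgue \<longrightarrow> A\<^sub>2 \<in> sets lebesgue \<longrightarrow> A\<^sub>1 \<subseteq> \<Omega> \<longrightarrow> A\<^sub>2 \<subseteq> \<Omega> \<longrightarrow>
        A\<^sub>1 \<inter> A\<^sub>2 = {} \<longrightarrow>
        (AE x in lebesgue_on \<Omega>. \<phi> x = indicator A\<^sub>1 x + \<nu> * indicator A\<^sub>2 x) \<longrightarrow>
        measure lebesgue A\<^sub>1 + \<nu> * measure lebesgue A\<^sub>2 = m\<^sub>0 \<and>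
        primitive p 1 * measure lebesgue A\<^sub>1 + primitive p \<nu> * measure lebesgue A\<^sub>2
          = - energy_limit 2 \<Omega> p u) \<and>
     (\<forall>\<xi> A\<^sub>1. H3 \<Omega> u\<^sub>0 \<longrightarrow> \<xi> < 0 \<longrightarrow>
        A\<^sub>1 \<in> sets lebesgue \<longrightarrow> A\<^sub>1 \<subseteq> \<Omega> \<longrightarrow> measure lebesgue A\<^sub>1 \<noteq> 0 \<longrightarrow>
        (AE x in lebesgue_on \<Omega>. \<phi> x = \<xi> * indicator A\<^sub>1 x) \<longrightarrow>
        \<xi> * measure lebesgue A\<^sub>1 = m\<^sub>0 \<and>
        primitive p \<xi> * measure lebesgue A\<^sub>1 = energy_limit 3 \<Omega> p u)"
proof -
  have \<Omega>: "\<Omega> \<in> lmeasurable" using assms(1,2) by (rule lmeasurable_open[rotated])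
  obtain p' where p': "\<And>s. (p has_real_derivative p' s) (at s)" "continuous_on UNIV p'"
    using assms(3) by (auto simp: C1_differentiable_on_def has_real_derivative_iff_has_vector_derivative)
  obtain g' where g': "\<And>s. (g has_real_derivative g' s) (at s)" "continuous_on UNIV g'"
    using assms(5) by (auto simp: C1_differentiable_on_def has_real_derivative_iff_has_vector_derivative)
  interpret nonlocal_solution \<Omega> p p' g g' u\<^sub>0 u
    by unfold_locales (use \<Omega> p' g' assms strict_mono_mono in \<open>auto simp: H1_def H2_def H3_def\<close>)
  have g_nonneg: "0 \<le> g s" if "0 \<le> s" "s \<le> 1" for s
    using assms(6,7) assms(8)[of s] that by (cases "s = 0"; cases "s = 1") auto
  have g_nonpos: "g s \<le> 0" if "s \<le> 0 \<or> 1 \<le> s" for s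
    using assms(6,7) assms(9)[of s] that by (cases "s = 0"; cases "s = 1") auto
  have 1: "\<mu> * measure lebesgue A\<^sub>1 + measure lebesgue \<Omega> - measure lebesgue A\<^sub>1 = m\<^sub>0 \<and>
        primitive p \<mu> * measure lebesgue A\<^sub>1
          + primitive p 1 * (measure lebesgue \<Omega> - measure lebesgue A\<^sub>1) = energy_limit 1 \<Omega> p u"
    if H: "H1 \<Omega> u\<^sub>0" and A: "A\<^sub>1 \<in> sets lebesgue" "A\<^sub>1 \<subseteq> \<Omega>"
      and \<phi>: "AE x in M. \<phi> x = \<mu> * indicator A\<^sub>1 x + indicator (\<Omega> - A\<^sub>1) x" for \<mu> A\<^sub>1
  proof -
    obtain R where R: "0 \<le> R" "AE x in M. \<bar>u\<^sub>0 x\<bar> \<le> R"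
      using H Linf_AE_bounded[of u\<^sub>0 \<Omega>] by (auto simp: H1_def)
    have ge: "AE x in M. 1 \<le> u t x" if "0 \<le> t" for t
      using barrier[of 1 "-1" t] H that assms(7) by (auto simp: H1_def)
    have sign: "AE x in M. g (u t x) \<le> 0" if "0 \<le> t" for t
      using ge[OF that] by eventually_elim (simp add: g_nonpos)
    \<comment> \<open>R is in general not a zero of g, so the upper bound comes from the convex
      barrier, whose sign condition follows from the lower barrier at 1.\<close>
    have le: "AE x in M. u t x \<le> R" if "0 \<le> t" for t
    proof -
      have "AE x in M. 1 * (u\<^sub>0 x - R) \<le> 0" using R(2) by eventually_elim simp
      from convex_barrier[OF sign _ this that] show ?thesis by simp
    qed
    have bound: "AE x in M. \<bar>u t x\<bar> \<le> R" if "0 \<le> t" for t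
      using ge[OF that] le[OF that] by eventually_elim simp
    have m: "measure lebesgue (\<Omega> - A\<^sub>1) = measure lebesgue \<Omega> - measure lebesgue A\<^sub>1"
      using A \<Omega> by (intro measurable_measure_Diff) auto
    have sign': "AE x in M. 0 \<le> - 1 * g (u t x)" if "0 \<le> t" for t
      using sign[OF that] by eventually_elim simp
    have B: "\<Omega> - A\<^sub>1 \<in> sets lebesgue" "\<Omega> - A\<^sub>1 \<subseteq> \<Omega>" "A\<^sub>1 \<inter> (\<Omega> - A\<^sub>1) = {}"
      using A \<Omega> by auto
    have \<phi>': "AE x in M. \<phi> x = \<mu> * indicator A\<^sub>1 x + 1 * indicator (\<Omega> - A\<^sub>1) x"
      using \<phi> by simp
    note * = omega_limit_two_valued[OF _ sign' bound assms(12) \<phi>' A B]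
    have "\<mu> * measure lebesgue A\<^sub>1 + measure lebesgue (\<Omega> - A\<^sub>1) = m\<^sub>0"
      using *(1) assms(13) by simp
    moreover have "((\<lambda>t. LINT x|M. primitive p (u t x)) \<longlongrightarrow>
        primitive p \<mu> * measure lebesgue A\<^sub>1 + primitive p 1 * measure lebesgue (\<Omega> - A\<^sub>1)) at_top"
      using *(2) by simp
    ultimately show ?thesis
      unfolding energy_limit_def energy_def m by (simp add: tendsto_Lim)
  qed
  have 2: "measure lebesgue A\<^sub>1 + \<nu> * measure lebesgue A\<^sub>2 = m\<^sub>0 \<and>
        primitive p 1 * measure lebesgue A\<^sub>1 + primitive p \<nu> * measure lebesgue A\<^sub>2
          = - energy_limit 2 \<Omega> p u"
    if H: "H2 \<Omega> g u\<^sub>0" and A: "A\<^sub>1 \<in> sets lebesgue" "A\<^sub>2 \<in> sets lebesgue" "A\<^sub>1 \<subseteq> \<Omega>" "A\<^sub>2 \<subseteq> \<Omega>"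
      "A\<^sub>1 \<inter> A\<^sub>2 = {}" and \<phi>: "AE x in M. \<phi> x = indicator A\<^sub>1 x + \<nu> * indicator A\<^sub>2 x" for \<nu> A\<^sub>1 A\<^sub>2
  proof -
    have ge: "AE x in M. 0 \<le> u t x" if "0 \<le> t" for t
      using barrier[of 0 "-1" t] H that assms(6) by (auto simp: H2_def)
    \<comment> \<open>Both 0 and 1 are zeros of g, so \<open>barrier\<close> alone confines u to
      [0,1] and already gives the uniform bound.\<close>
    have le: "AE x in M. u t x \<le> 1" if "0 \<le> t" for t
      using barrier[of 1 1 t] H that assms(7) by (auto simp: H2_def)
    have sign: "AE x in M. 0 \<le> g (u t x)" if "0 \<le> t" for t
      using ge[OF that] le[OF that] by eventually_elim (rule g_nonneg)
    have bound: "AE x in M. \<bar>u t x\<bar> \<le> 1" if "0 \<le> t" for t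
      using ge[OF that] le[OF that] by eventually_elim simp
    have sign': "AE x in M. 0 \<le> 1 * g (u t x)" if "0 \<le> t" for t
      using sign[OF that] by simp
    have \<phi>': "AE x in M. \<phi> x = 1 * indicator A\<^sub>1 x + \<nu> * indicator A\<^sub>2 x"
      using \<phi> by simp
    note * = omega_limit_two_valued[OF _ sign' bound assms(12) \<phi>' A(1,3,2,4,5)]
    have "measure lebesgue A\<^sub>1 + \<nu> * measure lebesgue A\<^sub>2 = m\<^sub>0"
      using *(1) assms(13) by simp
    moreover have "((\<lambda>t. LINT x|M. primitive p (u t x)) \<longlongrightarrow>
        primitive p 1 * measure lebesgue A\<^sub>1 + primitive p \<nu> * measure lebesgue A\<^sub>2) at_top"
      using *(2) by simp
    \<comment> \<open>The energy with index 2 carries the factor (-1)^3, which produces the minus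
      sign of the claim.\<close>
    then have "((\<lambda>t. - (LINT x|M. primitive p (u t x))) \<longlongrightarrow>
        - (primitive p 1 * measure lebesgue A\<^sub>1 + primitive p \<nu> * measure lebesgue A\<^sub>2)) at_top"
      by (rule tendsto_minus)
    ultimately show ?thesis
      unfolding energy_limit_def energy_def by (simp add: tendsto_Lim)
  qed
  have 3: "\<xi> * measure lebesgue A\<^sub>1 = m\<^sub>0 \<and>
        primitive p \<xi> * measure lebesgue A\<^sub>1 = energy_limit 3 \<Omega> p u"
    if H: "H3 \<Omega> u\<^sub>0" and A: "A\<^sub>1 \<in> sets lebesgue" "A\<^sub>1 \<subseteq> \<Omega>"
      and \<phi>: "AE x in M. \<phi> x = \<xi> * indicator A\<^sub>1 x" for \<xi> A\<^sub>1
  proof -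
    obtain R where R: "0 \<le> R" "AE x in M. \<bar>u\<^sub>0 x\<bar> \<le> R"
      using H Linf_AE_bounded[of u\<^sub>0 \<Omega>] by (auto simp: H3_def)
    have le: "AE x in M. u t x \<le> 0" if "0 \<le> t" for t
      using barrier[of 0 1 t] H that assms(6) by (auto simp: H3_def)
    have sign: "AE x in M. g (u t x) \<le> 0" if "0 \<le> t" for t
      using le[OF that] by eventually_elim (simp add: g_nonpos)
    \<comment> \<open>Mirror image of the first case: the convex barrier now acts from below, at the
      level -R.\<close>
    have ge: "AE x in M. - R \<le> u t x" if "0 \<le> t" for t
    proof -
      have "AE x in M. - 1 * (u\<^sub>0 x - - R) \<le> 0" using R(2) by eventually_elim simp
      from convex_barrier[OF sign _ this that]
      have "AE x in M. - 1 * (u t x - - R) \<le> 0" by simp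
      then show ?thesis by eventually_elim simp
    qed
    have bound: "AE x in M. \<bar>u t x\<bar> \<le> R" if "0 \<le> t" for t
      using ge[OF that] le[OF that] by eventually_elim simp
    have sign': "AE x in M. 0 \<le> - 1 * g (u t x)" if "0 \<le> t" for t
      using sign[OF that] by eventually_elim simp
    \<comment> \<open>An empty second set with value 0 brings the single-step profile into
      two-valued form.\<close>
    have \<phi>': "AE x in M. \<phi> x = \<xi> * indicator A\<^sub>1 x + 0 * indicator {} x"
      using \<phi> by simp
    note * = omega_limit_two_valued[OF _ sign' bound assms(12) \<phi>' A sets.empty_sets empty_subsetI Int_empty_right]
    have "\<xi> * measure lebesgue A\<^sub>1 = m\<^sub>0"
      using *(1) assms(13) by simp
    moreover have "((\<lambda>t. LINT x|M. primitive p (u t x)) \<longlongrightarrow>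
        primitive p \<xi> * measure lebesgue A\<^sub>1) at_top"
      using *(2) by simp
    ultimately show ?thesis
      unfolding energy_limit_def energy_def by (simp add: tendsto_Lim)
  qed
  show ?thesis
    by (rule conjI[OF _ conjI]; intro allI impI; rule 1 2 3; assumption)
qed

end
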